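(* There exists an absolute constant $c_1>0$ such that the following holds. For every positive integer $d$, all real numbers $\alpha_1,\dots,\alpha_d$, and every integer $N\geq 1$, there exists an integer $1\leq n\leq N$ such that \[\|n^2\alpha_j\|\leq \exp\bigl(-c_1(d^{-10}\log N)^{1/4}\bigr)\quad\text{for } j=1,\dots,d.\]
   Context: For $\alpha\in\mathbb R$, $\|\alpha\|$ denotes the distance from $\alpha$ to the nearest integer. *)

theory Defs
  imports Complex_Main
begin

definition dist_int :: "real \<Rightarrow> real" where
  "dist_int x = (INF k\<in>(\<int>::real set). \<bar>x - k\<bar>)"

end

theory Submission
  imports Defs "HOL-Analysis.Kronecker_Approximation_Theorem" "HOL-Analysis.Harmonic_Numbers"
begin

text \<open>
  Dirichlet's theorem, applied successively, gives positive integers \<open>x\<^sub>i\<close> whose cross terms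
  \<open>x\<^sub>i x\<^sub>j \<alpha>\<close> with \<open>i \<noteq> j\<close> are all close to \<open>0\<close> modulo 1, so that the square of a combination
  \<open>\<Sum> b\<^sub>i x\<^sub>i\<close>, multiplied by \<open>\<alpha>\<close>, is close to \<open>\<Sum> b\<^sub>i\<^sup>2 w\<^sub>i\<close> with \<open>w\<^sub>i = x\<^sub>i\<^sup>2 \<alpha>\<close>. The pigeonhole
  principle on subset sums, used twice, gives either a nonempty set on which the \<open>w\<^sub>i\<close> sum to almost
  \<open>0\<close>, or four disjoint nonempty sets \<open>A\<^sub>s\<close> on which they have almost the same sum \<open>v\<close>. In the second
  case choose \<open>c\<close> by Dirichlet with \<open>c v\<close> close to \<open>0\<close>, write \<open>c = \<Sum> a\<^sub>s\<^sup>2\<close> as a sum of four squares,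
  and give \<open>x\<^sub>i\<close> the coefficient \<open>a\<^sub>s\<close> for \<open>i \<in> A\<^sub>s\<close>. About \<open>(d\<^sup>2 log (1/\<epsilon>))\<^sup>2\<close> numbers \<open>x\<^sub>i\<close> suffice
  for precision \<open>\<epsilon>\<close>, which costs \<open>log N\<close> of order \<open>d\<^sup>6 log\<^sup>3 (1/\<epsilon>)\<close>.
\<close>

section \<open>Lagrange's four-square theorem\<close>

definition sum_four_squares :: "int \<Rightarrow> bool" where
  "sum_four_squares n \<longleftrightarrow> (\<exists>a b c d. n = a\<^sup>2 + b\<^sup>2 + c\<^sup>2 + d\<^sup>2)"

text \<open>Multiplicativity of the quaternion norm, applied to the second quaternion times the
  conjugate of the first. With the conjugate, all four entries vanish modulo \<open>m\<close> when
  the two are congruent modulo \<open>m\<close> and have norm divisible by \<open>m\<close>.\<close>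

lemma euler_four_square_identity:
  fixes a b c d p q r s :: int
  shows "(a\<^sup>2 + b\<^sup>2 + c\<^sup>2 + d\<^sup>2) * (p\<^sup>2 + q\<^sup>2 + r\<^sup>2 + s\<^sup>2) =
    (a * p + b * q + c * r + d * s)\<^sup>2 + (a * q - b * p + c * s - d * r)\<^sup>2 +
    (a * r - b * s - c * p + d * q)\<^sup>2 + (a * s + b * r - c * q - d * p)\<^sup>2"
  by algebra

lemma sum_four_squares_mult:
  "sum_four_squares m \<Longrightarrow> sum_four_squares n \<Longrightarrow> sum_four_squares (m * n)"
  unfolding sum_four_squares_def using euler_four_square_identity by metis

text \<open>An even number of the four roots is odd, so they pair off with equal parity; then
  \<open>((a + b) / 2)^2 + ((a - b) / 2)^2\<close> is half of \<open>a^2 + b^2\<close>.\<close>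

lemma sum_four_squares_half:
  assumes "sum_four_squares (2 * n)"
  shows "sum_four_squares n"
proof -
  have paired: "sum_four_squares n"
    if eq: "2 * n = a\<^sup>2 + b\<^sup>2 + c\<^sup>2 + d\<^sup>2" and ev: "even (a + b)" "even (c + d)" for a b c d
  proof -
    obtain u v where "a + b = 2 * u" "c + d = 2 * v"
      using ev by (meson evenE)
    then have uv: "a = 2 * u - b" "c = 2 * v - d" by auto
    have "2 * n = 2 * (u\<^sup>2 + (u - b)\<^sup>2 + v\<^sup>2 + (v - d)\<^sup>2)"
      unfolding eq uv by (simp add: power2_eq_square algebra_simps)
    then have "n = u\<^sup>2 + (u - b)\<^sup>2 + v\<^sup>2 + (v - d)\<^sup>2" by simp
    then show ?thesis unfolding sum_four_squares_def by blast
  qed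
  obtain a b c d where eq: "2 * n = a\<^sup>2 + b\<^sup>2 + c\<^sup>2 + d\<^sup>2"
    using assms unfolding sum_four_squares_def by blast
  then have "even (a\<^sup>2 + b\<^sup>2 + c\<^sup>2 + d\<^sup>2)" by (metis dvd_triv_left)
  then have "even (a + b) \<and> even (c + d) \<or> even (a + c) \<and> even (b + d) \<or> even (a + d) \<and> even (b + c)"
    by auto
  then show ?thesis
    using paired[of a b c d] paired[of a c b d] paired[of a d b c] eq by (auto simp: algebra_simps)
qed

text \<open>Pigeonhole: on the \<open>(p + 1) / 2\<close> integers below \<open>p / 2\<close> the
  maps \<open>x^2\<close> and \<open>-1 - y^2\<close> are injective modulo \<open>p\<close>, so
  their images are too large to be disjoint. The size bounds start the descent with a multiplier
  below \<open>p\<close>.\<close>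

lemma prime_dvd_two_squares_plus_one:
  fixes p :: int
  assumes "prime p" "odd p"
  obtains x y where "p dvd x\<^sup>2 + y\<^sup>2 + 1" "0 \<le> x" "2 * x < p" "0 \<le> y" "2 * y < p"
proof -
  define h where "h = (p - 1) div 2"
  have p: "p = 2 * h + 1" "0 \<le> h" "p > 1"
    using assms prime_gt_1_int[of p] by (auto simp: h_def elim!: oddE)
  have inj: "x = y" if "p dvd x\<^sup>2 - y\<^sup>2" "x \<in> {0..h}" "y \<in> {0..h}" for x y
  proof -
    have "p dvd (x + y) * (x - y)" using that by (simp add: power2_eq_square algebra_simps)
    then have "p dvd x + y \<or> p dvd x - y" using assms prime_dvd_mult_iff by blast
    moreover have "\<bar>x + y\<bar> < p" "\<bar>x - y\<bar> < p" using that p by auto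
    ultimately have "x + y = 0 \<or> x - y = 0" using zdvd_not_zless p
      by (smt (verit, best) dvd_imp_le_int)
    then show ?thesis using that by auto
  qed
  define A where "A = (\<lambda>x. x\<^sup>2 mod p) ` {0..h}"
  define B where "B = (\<lambda>y. (- 1 - y\<^sup>2) mod p) ` {0..h}"
  have "inj_on (\<lambda>x. x\<^sup>2 mod p) {0..h}"
    by (intro inj_onI inj) (auto simp: mod_eq_dvd_iff)
  then have A: "card A = nat (h + 1)" by (simp add: A_def card_image)
  have "inj_on (\<lambda>y. (- 1 - y\<^sup>2) mod p) {0..h}"
    by (rule inj_onI, rule sym, rule inj) (auto simp: mod_eq_dvd_iff)
  then have B: "card B = nat (h + 1)" by (simp add: B_def card_image)
  have "A \<union> B \<subseteq> {0..<p}" using pos_mod_bound[of p] p(3) by (auto simp: A_def B_def)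
  then have "card (A \<union> B) \<le> nat p" using card_mono[of "{0..<p}" "A \<union> B"] by simp
  then have "A \<inter> B \<noteq> {}"
    using card_Un_disjoint[of A B] A B p by (fastforce simp: A_def B_def)
  then obtain x y where xy: "x \<in> {0..h}" "y \<in> {0..h}" "x\<^sup>2 mod p = (- 1 - y\<^sup>2) mod p"
    unfolding A_def B_def by blast
  then have "p dvd x\<^sup>2 + y\<^sup>2 + 1" by (simp add: mod_eq_dvd_iff algebra_simps)
  then show ?thesis using that[of x y] xy p by auto
qed

text \<open>Oddness of \<open>m\<close> excludes a residue of exactly \<open>m / 2\<close>. The
  strict inequality is what makes the descent decrease.\<close>

lemma centered_residue:
  fixes m x :: int
  assumes "odd m" "m > 0"
  obtains u where "2 * \<bar>x - m * u\<bar> < m"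
proof -
  define h where "h = (m - 1) div 2"
  have m: "m = 2 * h + 1" using assms by (auto simp: h_def elim!: oddE)
  have "x - m * ((x + h) div m) = (x + h) mod m - h" by (simp add: minus_mult_div_eq_mod[symmetric])
  moreover have "0 \<le> (x + h) mod m" "(x + h) mod m < m" using assms by auto
  ultimately have "2 * \<bar>x - m * ((x + h) div m)\<bar> < m"
    using m by (simp only:) (simp add: abs_if)
  then show ?thesis by (rule that)
qed

text \<open>Replacing the four roots by their centered residues modulo \<open>m\<close> gives a sum
  of squares \<open>m * r\<close> with \<open>r < m\<close>. Euler's identity writes
  \<open>(m * p) * (m * r)\<close> as four squares of multiples of \<open>m\<close>, and
  \<open>m^2\<close> cancels.\<close>

lemma sum_four_squares_descent:
  fixes m p :: int
  assumes "prime p" "1 < m" "m < p" "odd m" "sum_four_squares (m * p)"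
  obtains r where "0 < r" "r < m" "sum_four_squares (r * p)"
proof -
  obtain a b c d where eq: "m * p = a\<^sup>2 + b\<^sup>2 + c\<^sup>2 + d\<^sup>2"
    using assms unfolding sum_four_squares_def by blast
  have "m > 0" using \<open>1 < m\<close> by simp
  note residue = centered_residue[OF \<open>odd m\<close> this]
  obtain ta where ta: "2 * \<bar>a - m * ta\<bar> < m" by (rule residue)
  obtain tb where tb: "2 * \<bar>b - m * tb\<bar> < m" by (rule residue)
  obtain tc where tc: "2 * \<bar>c - m * tc\<bar> < m" by (rule residue)
  obtain td where td: "2 * \<bar>d - m * td\<bar> < m" by (rule residue)
  define a' b' c' d' where defs: "a' = a - m * ta" "b' = b - m * tb" "c' = c - m * tc" "d' = d - m * td"
  \<comment> \<open>The quotient by \<open>m\<close> of the sum of squared residues, expanded with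
    \<open>m * p\<close> in place of the original sum of squares.\<close>
  define r where "r = p - 2 * (a * ta + b * tb + c * tc + d * td) + m * (ta\<^sup>2 + tb\<^sup>2 + tc\<^sup>2 + td\<^sup>2)"
  have mr: "m * r = a'\<^sup>2 + b'\<^sup>2 + c'\<^sup>2 + d'\<^sup>2"
    using eq unfolding r_def defs by algebra
  have sq: "4 * z\<^sup>2 < m\<^sup>2" if "2 * \<bar>z\<bar> < m" for z
    using power_strict_mono[OF that, of 2] by (simp add: power_mult_distrib)
  have "4 * (m * r) < 4 * (m * m)"
    unfolding mr using sq[OF ta] sq[OF tb] sq[OF tc] sq[OF td]
    by (simp add: defs power2_eq_square[of m])
  then have "r < m" using \<open>1 < m\<close> by simp
  have "m * r \<ge> 0" unfolding mr by simp
  then have "r \<ge> 0" using \<open>1 < m\<close> by (simp add: zero_le_mult_iff)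
  \<comment> \<open>If all residues vanish then \<open>m^2\<close> divides \<open>m * p\<close>, so
    \<open>m\<close> divides \<open>p\<close>, impossible for \<open>1 < m < p\<close>.\<close>
  moreover have "r \<noteq> 0"
  proof
    assume "r = 0"
    then have "a'\<^sup>2 + b'\<^sup>2 + c'\<^sup>2 + d'\<^sup>2 = 0" using mr by simp
    then have "a'\<^sup>2 = 0 \<and> b'\<^sup>2 = 0 \<and> c'\<^sup>2 = 0 \<and> d'\<^sup>2 = 0"
      by (smt (verit) zero_le_power2)
    then have "a = m * ta" "b = m * tb" "c = m * tc" "d = m * td" using defs by auto
    then have "m * p = m * (m * (ta\<^sup>2 + tb\<^sup>2 + tc\<^sup>2 + td\<^sup>2))"
      using eq by (simp add: power2_eq_square algebra_simps)
    then have "m dvd p" using \<open>1 < m\<close> by simp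
    then show False using assms(1-3) prime_int_iff by (metis less_irrefl less_trans zero_less_one less_imp_le)
  qed
  ultimately have "r > 0" by simp
  \<comment> \<open>The entries of Euler's identity already divided by \<open>m\<close>.\<close>
  define w1 w2 w3 w4 where w: "w1 = p - (a * ta + b * tb + c * tc + d * td)"
    "w2 = b * ta - a * tb + d * tc - c * td" "w3 = b * td - a * tc + c * ta - d * tb"
    "w4 = c * tb - a * td - b * tc + d * ta"
  have z1: "a * a' + b * b' + c * c' + d * d' = m * w1"
    using eq unfolding defs w by algebra
  have z: "a * b' - b * a' + c * d' - d * c' = m * w2"
    "a * c' - b * d' - c * a' + d * b' = m * w3" "a * d' + b * c' - c * b' - d * a' = m * w4"
    unfolding defs w by (simp_all add: algebra_simps)
  have "m\<^sup>2 * (r * p) = (a\<^sup>2 + b\<^sup>2 + c\<^sup>2 + d\<^sup>2) * (a'\<^sup>2 + b'\<^sup>2 + c'\<^sup>2 + d'\<^sup>2)"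
    unfolding eq[symmetric] mr[symmetric] by (simp add: power2_eq_square)
  also have "\<dots> = m\<^sup>2 * (w1\<^sup>2 + w2\<^sup>2 + w3\<^sup>2 + w4\<^sup>2)"
    unfolding euler_four_square_identity z1 z by (simp add: power_mult_distrib algebra_simps)
  finally have "r * p = w1\<^sup>2 + w2\<^sup>2 + w3\<^sup>2 + w4\<^sup>2"
    using \<open>1 < m\<close> by simp
  then have "sum_four_squares (r * p)" unfolding sum_four_squares_def by blast
  then show ?thesis using that \<open>r > 0\<close> \<open>r < m\<close> by blast
qed

lemma sum_four_squares_prime:
  fixes p :: int
  assumes "prime p"
  shows "sum_four_squares p"
proof (cases "odd p")
  case False
  then have "p = 2" using assms primes_dvd_imp_eq two_is_prime by metis
  moreover have "(2::int) = 1\<^sup>2 + 1\<^sup>2 + 0\<^sup>2 + 0\<^sup>2" by simp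
  ultimately show ?thesis unfolding sum_four_squares_def by metis
next
  case True
  have descent: "sum_four_squares p" if "0 < m" "int m < p" "sum_four_squares (int m * p)" for m
    using that
  proof (induction m rule: less_induct)
    case (less m)
    consider "m = 1" | k where "m = 2 * k" | "m > 1" "odd m"
      using less.prems by (metis evenE less_one linorder_neqE_nat not_less_zero)
    then show ?case
    proof cases
      case 1
      then show ?thesis using less.prems by simp
    next
      case 2
      then have "sum_four_squares (int k * p)"
        using less.prems sum_four_squares_half[of "int k * p"] by (simp add: mult.assoc)
      then show ?thesis using 2 less.IH[of k] less.prems by auto
    next
      case 3
      then obtain r where r: "0 < r" "r < int m" "sum_four_squares (r * p)"
        using sum_four_squares_descent[OF assms, of "int m"] less.prems by auto
      then show ?thesis using less.IH[of "nat r"] less.prems by simp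
    qed
  qed
  obtain x y where xy: "p dvd x\<^sup>2 + y\<^sup>2 + 1" "0 \<le> x" "2 * x < p" "0 \<le> y" "2 * y < p"
    using prime_dvd_two_squares_plus_one[OF assms True] .
  have p1: "p > 1" using assms prime_gt_1_int by simp
  from xy obtain m where m: "x\<^sup>2 + y\<^sup>2 + 1 = p * m" by (auto elim: dvdE)
  \<comment> \<open>Since \<open>2 * x + 1\<close> and \<open>2 * y + 1\<close> are at most
    \<open>p\<close>, four times \<open>x^2 + y^2 + 1\<close> is at most \<open>2 * p^2 + 2\<close>,
    which is below \<open>4 * p^2\<close>.\<close>
  have "(2 * x + 1)\<^sup>2 \<le> p\<^sup>2" "(2 * y + 1)\<^sup>2 \<le> p\<^sup>2" using xy by (auto intro!: power_mono)
  moreover have "p * p > 1" using p1 by (metis less_1_mult)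
  ultimately have "4 * (p * m) < 4 * (p * p)"
    unfolding m[symmetric] using xy p1 by (simp add: power2_eq_square algebra_simps)
  then have "m < p" using p1 by simp
  moreover have "p * m > 0" unfolding m[symmetric] by (smt (verit) zero_le_power2)
  then have "m > 0" using p1 by (simp add: zero_less_mult_iff)
  moreover have "m * p = x\<^sup>2 + y\<^sup>2 + 1\<^sup>2 + 0\<^sup>2" using m by (simp add: mult.commute)
  then have "sum_four_squares (m * p)" unfolding sum_four_squares_def by blast
  ultimately show ?thesis using descent[of "nat m"] by simp
qed

theorem lagrange_four_squares:
  fixes n :: nat
  obtains a b c d :: nat where "n = a\<^sup>2 + b\<^sup>2 + c\<^sup>2 + d\<^sup>2"
proof -
  have "sum_four_squares (int n)"
  proof (induction n rule: prime_divisors_induct)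
    case zero
    have "(0::int) = 0\<^sup>2 + 0\<^sup>2 + 0\<^sup>2 + 0\<^sup>2" by simp
    then show ?case unfolding sum_four_squares_def of_nat_0 by blast
  next
    case (unit x)
    have "(1::int) = 1\<^sup>2 + 0\<^sup>2 + 0\<^sup>2 + 0\<^sup>2" by simp
    then show ?case using unit unfolding sum_four_squares_def by (metis nat_dvd_1_iff_1 of_nat_1)
  next
    case (factor p x)
    then show ?case by (simp add: sum_four_squares_mult sum_four_squares_prime)
  qed
  then obtain a b c d :: int where "int n = a\<^sup>2 + b\<^sup>2 + c\<^sup>2 + d\<^sup>2"
    unfolding sum_four_squares_def by blast
  then have "int n = int ((nat \<bar>a\<bar>)\<^sup>2 + (nat \<bar>b\<bar>)\<^sup>2 + (nat \<bar>c\<bar>)\<^sup>2 + (nat \<bar>d\<bar>)\<^sup>2)" by simp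
  then show ?thesis using that of_nat_eq_iff by blast
qed

section \<open>Distance to the nearest integer\<close>

lemma dist_int_eq_round: "dist_int x = \<bar>x - of_int (round x)\<bar>"
  unfolding dist_int_def
proof (rule cInf_eq_minimum)
  show "\<bar>x - of_int (round x)\<bar> \<in> (\<lambda>k. \<bar>x - k\<bar>) ` \<int>" by simp
  show "\<bar>x - of_int (round x)\<bar> \<le> y" if "y \<in> (\<lambda>k. \<bar>x - k\<bar>) ` \<int>" for y
    using that round_diff_minimal[of x] by (auto elim!: Ints_cases)
qed

lemma dist_int_le: "dist_int x \<le> \<bar>x - of_int k\<bar>"
  unfolding dist_int_eq_round by (rule round_diff_minimal)

lemma dist_int_le_abs: "dist_int x \<le> \<bar>x\<bar>"
  using dist_int_le[of x 0] by simp

lemma dist_int_nonneg: "0 \<le> dist_int x"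
  by (simp add: dist_int_eq_round)

lemma dist_int_le_half: "dist_int x \<le> 1 / 2"
  unfolding dist_int_eq_round using of_int_round_abs_le[of x] by (simp add: abs_minus_commute)

lemma dist_int_add: "dist_int (x + y) \<le> dist_int x + dist_int y"
  using dist_int_le[of "x + y" "round x + round y"] by (simp add: dist_int_eq_round)

lemma dist_int_minus: "dist_int (- x) = dist_int x"
  using dist_int_le[of "- x" "- round x"] dist_int_le[of x "- round (- x)"]
  by (simp add: dist_int_eq_round)

lemma dist_int_diff_commute: "dist_int (x - y) = dist_int (y - x)"
  using dist_int_minus[of "x - y"] by simp

lemma dist_int_sum: "dist_int (\<Sum>i\<in>A. f i) \<le> (\<Sum>i\<in>A. dist_int (f i))"
proof (induction A rule: infinite_finite_induct)
  case (insert x F)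
  then show ?case using dist_int_add[of "f x" "sum f F"] by simp
qed (use dist_int_le_abs[of 0] in auto)

lemma dist_int_nat_mult: "dist_int (real n * x) \<le> real n * dist_int x"
  using dist_int_sum[of "\<lambda>_. x" "{..<n}"] by simp

lemma dist_int_triangle: "dist_int (x - z) \<le> dist_int (x - y) + dist_int (y - z)"
  using dist_int_add[of "x - y" "y - z"] by simp

section \<open>Simultaneous Dirichlet approximation and integers with small cross terms\<close>

lemma dist_int_dirichlet:
  fixes \<theta> :: "nat \<Rightarrow> real"
  assumes "Q > 0"
  obtains q where "1 \<le> q" "q \<le> Q ^ n" "\<And>i. i < n \<Longrightarrow> dist_int (real q * \<theta> i) \<le> 1 / real Q"
proof -
  obtain q p where q: "0 < q" "q \<le> int (Q ^ n)"
    and qp: "\<And>i. i < n \<Longrightarrow> \<bar>of_int q * \<theta> i - of_int (p i)\<bar> < 1 / real Q"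
    using Dirichlet_approx_simult[OF assms, of n \<theta>] by metis
  have "dist_int (real (nat q) * \<theta> i) \<le> 1 / real Q" if "i < n" for i
    using qp[OF that] dist_int_le[of "of_int q * \<theta> i" "p i"] q by simp
  moreover have "1 \<le> nat q" "nat q \<le> Q ^ n" using q by (simp_all add: nat_le_iff)
  ultimately show ?thesis using that by blast
qed

text \<open>The integers are chosen one at a time: each new one approximates all products of an
  earlier \<open>x j\<close> with an \<open>\<alpha> l\<close>, at most \<open>K * d\<close>
  numbers, whence the exponent.\<close>

lemma nearly_orthogonal_sequence:
  fixes \<alpha> :: "nat \<Rightarrow> real"
  assumes "E > 0"
  obtains x :: "nat \<Rightarrow> nat" where "\<And>i. i < K \<Longrightarrow> 1 \<le> x i" "\<And>i. i < K \<Longrightarrow> x i \<le> E ^ (K * d)"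
    "\<And>i j l. \<lbrakk>i < K; j < K; i \<noteq> j; l < d\<rbrakk> \<Longrightarrow> dist_int (real (x i) * real (x j) * \<alpha> l) \<le> 1 / real E"
proof -
  have "\<exists>x :: nat \<Rightarrow> nat. \<forall>i<K. 1 \<le> x i \<and> x i \<le> E ^ (K * d) \<and>
      (\<forall>j<i. \<forall>l<d. dist_int (real (x i) * real (x j) * \<alpha> l) \<le> 1 / real E)"
  proof (induction K)
    case (Suc K)
    then obtain x :: "nat \<Rightarrow> nat" where x: "\<forall>i<K. 1 \<le> x i \<and> x i \<le> E ^ (K * d) \<and>
      (\<forall>j<i. \<forall>l<d. dist_int (real (x i) * real (x j) * \<alpha> l) \<le> 1 / real E)" by blast
    \<comment> \<open>The pair \<open>(j, l)\<close> is encoded as \<open>j * d + l\<close>, decoded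
      by \<open>div\<close> and \<open>mod\<close>.\<close>
    obtain q where q: "1 \<le> q" "q \<le> E ^ (K * d)"
      "\<And>i. i < K * d \<Longrightarrow> dist_int (real q * (real (x (i div d)) * \<alpha> (i mod d))) \<le> 1 / real E"
      using dist_int_dirichlet[OF assms, of "K * d" "\<lambda>i. real (x (i div d)) * \<alpha> (i mod d)"] by blast
    have new: "dist_int (real q * real (x j) * \<alpha> l) \<le> 1 / real E" if "j < K" "l < d" for j l
    proof -
      have "j * d + l < Suc j * d" using that by simp
      also have "\<dots> \<le> K * d" using that by (intro mult_right_mono) auto
      finally show ?thesis using q(3)[of "j * d + l"] that by (simp add: mult.assoc)
    qed
    have "E ^ (K * d) \<le> E ^ (Suc K * d)" using assms by (intro power_increasing) auto
    then show ?case using x q(1,2) new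
      by (intro exI[of _ "x(K := q)"]) (auto simp: less_Suc_eq intro: order_trans)
  qed simp
  then obtain x :: "nat \<Rightarrow> nat" where x: "\<forall>i<K. 1 \<le> x i \<and> x i \<le> E ^ (K * d) \<and>
      (\<forall>j<i. \<forall>l<d. dist_int (real (x i) * real (x j) * \<alpha> l) \<le> 1 / real E)" by blast
  have "dist_int (real (x i) * real (x j) * \<alpha> l) \<le> 1 / real E" if "i < K" "j < K" "i \<noteq> j" "l < d" for i j l
    using x that by (cases "j < i") (auto simp: mult.commute[of "real (x j)"])
  then show ?thesis using that x by blast
qed

section \<open>Subset sums modulo 1\<close>

text \<open>Pigeonhole of the \<open>2 ^ card B\<close> subsets into \<open>M ^ d\<close> boxes of
  side \<open>1 / M\<close> on the torus. Removing the common part of two colliding subsets makes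
  them disjoint without changing the difference of their sums.\<close>

lemma close_subset_sums:
  fixes w :: "'a \<Rightarrow> nat \<Rightarrow> real"
  assumes "finite B" "M > 0" "M ^ d < 2 ^ card B"
  obtains I J where "I \<subseteq> B" "J \<subseteq> B" "I \<inter> J = {}" "I \<noteq> {} \<or> J \<noteq> {}"
    "\<And>l. l < d \<Longrightarrow> dist_int ((\<Sum>i\<in>I. w i l) - (\<Sum>i\<in>J. w i l)) \<le> 1 / real M"
proof -
  define f where "f S = (\<lambda>l\<in>{..<d}. nat \<lfloor>real M * frac (\<Sum>i\<in>S. w i l)\<rfloor>)" for S
  have "nat \<lfloor>real M * frac t\<rfloor> < M" for t :: real
  proof -
    have "real M * frac t < real M" using assms frac_lt_1[of t] by simp
    then show ?thesis using assms by (simp add: nat_less_iff floor_less_iff)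
  qed
  then have "f ` Pow B \<subseteq> (\<Pi>\<^sub>E l\<in>{..<d}. {..<M})"
    unfolding f_def by (intro image_subsetI restrict_PiE_iff[THEN iffD2]) simp
  then have "card (f ` Pow B) \<le> M ^ d"
    using card_mono[of "\<Pi>\<^sub>E l\<in>{..<d}. {..<M}" "f ` Pow B"] by (simp add: finite_PiE card_PiE)
  then have "\<not> inj_on f (Pow B)"
    using assms by (auto dest!: card_image simp: card_Pow)
  then obtain S T where ST: "S \<subseteq> B" "T \<subseteq> B" "S \<noteq> T" "f S = f T"
    by (auto simp: inj_on_def)
  have fin: "finite S" "finite T" using ST assms finite_subset by auto
  have "dist_int ((\<Sum>i\<in>S - T. w i l) - (\<Sum>i\<in>T - S. w i l)) \<le> 1 / real M" if "l < d" for l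
  proof -
    define s t where "s = (\<Sum>i\<in>S. w i l)" and "t = (\<Sum>i\<in>T. w i l)"
    have "nat \<lfloor>real M * frac s\<rfloor> = nat \<lfloor>real M * frac t\<rfloor>"
      using fun_cong[OF ST(4), of l] that by (simp add: f_def s_def t_def)
    then have "\<lfloor>real M * frac s\<rfloor> = \<lfloor>real M * frac t\<rfloor>"
      by (simp add: eq_nat_nat_iff)
    then have "\<bar>real M * frac s - real M * frac t\<bar> < 1" by linarith
    then have "real M * \<bar>frac s - frac t\<bar> < 1"
      by (simp add: right_diff_distrib[symmetric] abs_mult)
    then have "\<bar>frac s - frac t\<bar> \<le> 1 / real M" using assms by (simp add: field_simps)
    moreover have "frac s - frac t = (s - t) - of_int (\<lfloor>s\<rfloor> - \<lfloor>t\<rfloor>)" by (simp add: frac_def)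
    ultimately have "dist_int (s - t) \<le> 1 / real M"
      using dist_int_le[of "s - t" "\<lfloor>s\<rfloor> - \<lfloor>t\<rfloor>"] by linarith
    moreover have "s = (\<Sum>i\<in>S - T. w i l) + (\<Sum>i\<in>S \<inter> T. w i l)"
      "t = (\<Sum>i\<in>T - S. w i l) + (\<Sum>i\<in>S \<inter> T. w i l)"
      using sum.Int_Diff[OF fin(1), of "\<lambda>i. w i l" T] sum.Int_Diff[OF fin(2), of "\<lambda>i. w i l" S]
      by (simp_all add: s_def t_def Int_commute)
    ultimately show ?thesis by simp
  qed
  then show ?thesis using that[of "S - T" "T - S"] ST by blast
qed

text \<open>Cut the indices into \<open>k\<close> blocks of length \<open>k\<close>. Each block
  yields disjoint \<open>I b\<close>, \<open>J b\<close> with close sums; a second pigeonhole on the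
  sums over \<open>I b\<close> yields disjoint sets \<open>P\<close>, \<open>R\<close> of blocks.
  The unions of \<open>I\<close> and of \<open>J\<close> over \<open>P\<close> and over
  \<open>R\<close> are the four sets, unless some set is empty, and then its partner has sum near
  zero.\<close>

lemma four_close_subset_sums:
  fixes w :: "nat \<Rightarrow> nat \<Rightarrow> real"
  assumes "M > 0" "M ^ d < 2 ^ k"
  shows "(\<exists>A \<subseteq> {..<k * k}. A \<noteq> {} \<and> (\<forall>l<d. dist_int (\<Sum>i\<in>A. w i l) \<le> 1 / real M)) \<or>
    (\<exists>A :: nat \<Rightarrow> nat set. (\<forall>s<4. A s \<subseteq> {..<k * k} \<and> A s \<noteq> {}) \<and> disjoint_family_on A {..<4} \<and>
      (\<forall>s<4. \<forall>l<d. dist_int ((\<Sum>i\<in>A s. w i l) - (\<Sum>i\<in>A 0. w i l)) \<le> real (k + 1) / real M))"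
    (is "?zero \<or> ?four")
proof (rule disjCI)
  assume "\<not> ?four"
  show ?zero
  proof (rule ccontr)
    assume "\<not> ?zero"
    then have no_zero: "A = {}"
      if "A \<subseteq> {..<k * k}" "\<And>l. l < d \<Longrightarrow> dist_int (\<Sum>i\<in>A. w i l) \<le> 1 / real M" for A
      using that by blast
    define B where "B b = {b * k..<Suc b * k}" for b
    have Bsub: "B b \<subseteq> {..<k * k}" if "b < k" for b
    proof -
      have "Suc b * k \<le> k * k" using that by (intro mult_right_mono) auto
      then show ?thesis by (auto simp: B_def)
    qed
    have Bdisj: "B b \<inter> B b' = {}" if "b \<noteq> b'" for b b'
    proof -
      have "b = i div k" if "i \<in> B b" for i b
        using that by (intro div_nat_eqI[symmetric]) (auto simp: B_def algebra_simps)
      then show ?thesis using that by blast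
    qed
    have "\<exists>I J. I \<subseteq> B b \<and> J \<subseteq> B b \<and> I \<inter> J = {} \<and> (I \<noteq> {} \<or> J \<noteq> {}) \<and>
       (\<forall>l<d. dist_int ((\<Sum>i\<in>I. w i l) - (\<Sum>i\<in>J. w i l)) \<le> 1 / real M)" for b
      using close_subset_sums[of "B b" M d w] assms by (simp add: B_def) metis
    then obtain I J where IJ: "\<And>b. I b \<subseteq> B b" "\<And>b. J b \<subseteq> B b" "\<And>b. I b \<inter> J b = {}"
      "\<And>b. I b \<noteq> {} \<or> J b \<noteq> {}"
      "\<And>b l. l < d \<Longrightarrow> dist_int ((\<Sum>i\<in>I b. w i l) - (\<Sum>i\<in>J b. w i l)) \<le> 1 / real M"
      by metis
    have ne: "I b \<noteq> {}" "J b \<noteq> {}" if "b < k" for b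
    proof -
      have "J b = {}" if "I b = {}"
        using no_zero[of "J b"] IJ(2)[of b] IJ(5)[of _ b] Bsub[OF \<open>b < k\<close>] that
        by (simp add: dist_int_minus)
      moreover have "I b = {}" if "J b = {}"
        using no_zero[of "I b"] IJ(1)[of b] IJ(5)[of _ b] Bsub[OF \<open>b < k\<close>] that by simp
      ultimately show "I b \<noteq> {}" "J b \<noteq> {}" using IJ(4) by auto
    qed
    \<comment> \<open>Second pigeonhole, with the blocks themselves as the elements.\<close>
    obtain P R where PR: "P \<subseteq> {..<k}" "R \<subseteq> {..<k}" "P \<inter> R = {}" "P \<noteq> {} \<or> R \<noteq> {}"
      "\<And>l. l < d \<Longrightarrow> dist_int ((\<Sum>b\<in>P. \<Sum>i\<in>I b. w i l) - (\<Sum>b\<in>R. \<Sum>i\<in>I b. w i l)) \<le> 1 / real M"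
      by (rule close_subset_sums[of "{..<k}" M d "\<lambda>b l. \<Sum>i\<in>I b. w i l"]) (simp_all add: assms)
    have fin: "finite (I b)" "finite (J b)" "finite P" "finite R" for b
      using finite_subset[OF IJ(1)] finite_subset[OF IJ(2)] finite_subset[OF PR(1)] finite_subset[OF PR(2)]
      by (simp_all add: B_def)
    have union_sum: "(\<Sum>i\<in>(\<Union>b\<in>S. F b). w i l) = (\<Sum>b\<in>S. \<Sum>i\<in>F b. w i l)"
      if "finite S" "F = I \<or> F = J" for S F l
    proof (rule sum.UNION_disjoint[OF that(1)])
      have "F b \<subseteq> B b" for b using that(2) IJ(1,2) by blast
      then show "\<forall>b\<in>S. \<forall>b'\<in>S. b \<noteq> b' \<longrightarrow> F b \<inter> F b' = {}" using Bdisj by blast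
    qed (use that(2) fin in auto)
    have union_sub: "(\<Union>b\<in>S. F b) \<subseteq> {..<k * k}" if "S \<subseteq> {..<k}" "F = I \<or> F = J" for S F
    proof (rule UN_least)
      fix b assume "b \<in> S"
      then have "b < k" using that(1) by blast
      then show "F b \<subseteq> {..<k * k}" using that(2) IJ(1,2)[of b] Bsub[of b] by blast
    qed
    have union_ne: "(\<Union>b\<in>S. F b) \<noteq> {}" if "S \<subseteq> {..<k}" "F = I \<or> F = J" "S \<noteq> {}" for S F
      using that ne by (auto simp: subset_iff)
    \<comment> \<open>If one of \<open>P\<close>, \<open>R\<close> is empty, the union over the
      other has sum near zero, so it is empty by \<open>no_zero\<close>, against
      \<open>union_ne\<close>.\<close>
    have "\<Union> (I ` R) = {}" if "P = {}"
      by (rule no_zero) (use PR that union_sub[of R I] in \<open>simp_all add: union_sum fin dist_int_minus\<close>)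
    moreover have "\<Union> (I ` P) = {}" if "R = {}"
      by (rule no_zero) (use PR that union_sub[of P I] in \<open>simp_all add: union_sum fin\<close>)
    ultimately have PRne: "P \<noteq> {}" "R \<noteq> {}"
      using PR(4) union_ne[OF PR(1), of I] union_ne[OF PR(2), of I] by auto
    define A where "A s = (if s = 0 then \<Union> (I ` P) else if s = 1 then \<Union> (J ` P)
      else if s = 2 then \<Union> (I ` R) else \<Union> (J ` R))" for s :: nat
    have four: "{..<4} = {0, 1, 2, 3::nat}" by auto
    \<comment> \<open>Exchanging \<open>I\<close> for \<open>J\<close> costs \<open>1 / M\<close>
      per block, hence at most \<open>k / M\<close>; passing between \<open>P\<close> and
      \<open>R\<close> costs the one further \<open>1 / M\<close>.\<close>
    have IJ_sum: "dist_int ((\<Sum>b\<in>S. \<Sum>i\<in>J b. w i l) - (\<Sum>b\<in>S. \<Sum>i\<in>I b. w i l)) \<le> real k / real M"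
      if "S \<subseteq> {..<k}" "l < d" for S l
    proof -
      have "dist_int ((\<Sum>b\<in>S. \<Sum>i\<in>J b. w i l) - (\<Sum>b\<in>S. \<Sum>i\<in>I b. w i l))
          = dist_int (\<Sum>b\<in>S. (\<Sum>i\<in>J b. w i l) - (\<Sum>i\<in>I b. w i l))"
        by (simp add: sum_subtractf)
      also have "\<dots> \<le> (\<Sum>b\<in>S. dist_int ((\<Sum>i\<in>J b. w i l) - (\<Sum>i\<in>I b. w i l)))"
        by (rule dist_int_sum)
      also have "\<dots> \<le> (\<Sum>b\<in>S. 1 / real M)"
        using IJ(5)[OF that(2)] by (intro sum_mono) (simp add: dist_int_diff_commute)
      also have "\<dots> \<le> real k / real M"
        using card_mono[OF _ that(1)] assms by (simp add: divide_right_mono)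
      finally show ?thesis .
    qed
    have "dist_int ((\<Sum>i\<in>A s. w i l) - (\<Sum>i\<in>A 0. w i l)) \<le> real (k + 1) / real M"
      if "s < 4" "l < d" for s l
    proof -
      define IP JP IR JR where "IP = (\<Sum>i\<in>A 0. w i l)" and "JP = (\<Sum>i\<in>A 1. w i l)"
        and "IR = (\<Sum>i\<in>A 2. w i l)" and "JR = (\<Sum>i\<in>A 3. w i l)"
      have "dist_int (JP - IP) \<le> real k / real M" "dist_int (JR - IR) \<le> real k / real M"
          "dist_int (IP - IR) \<le> 1 / real M"
        using IJ_sum[OF PR(1) that(2)] IJ_sum[OF PR(2) that(2)] PR(5)[OF that(2)]
        by (simp_all add: IP_def JP_def IR_def JR_def A_def union_sum fin)
      moreover from this have "dist_int (JR - IP) \<le> real k / real M + 1 / real M"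
        using dist_int_triangle[of JR IP IR] dist_int_diff_commute[of IR IP] by linarith
      moreover have "real k / real M + 1 / real M = real (k + 1) / real M"
        by (simp add: add_divide_distrib)
      moreover have "0 \<le> real k / real M" "0 \<le> 1 / real M" by simp_all
      ultimately have "dist_int (JP - IP) \<le> real (k + 1) / real M" "dist_int (IR - IP) \<le> real (k + 1) / real M"
          "dist_int (JR - IP) \<le> real (k + 1) / real M" "dist_int (IP - IP) \<le> real (k + 1) / real M"
        using dist_int_le_abs[of "IP - IP"] dist_int_diff_commute[of IR IP] by linarith+
      moreover have "s = 0 \<or> s = 1 \<or> s = 2 \<or> s = 3" using that by auto
      ultimately show ?thesis unfolding IP_def JP_def IR_def JR_def by (elim disjE) (simp_all only:)
    qed
    moreover have "A s \<subseteq> {..<k * k} \<and> A s \<noteq> {}" if "s < 4" for s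
      using union_sub[OF PR(1)] union_sub[OF PR(2)] union_ne[OF PR(1)] union_ne[OF PR(2)] PRne
      by (simp add: A_def)
    moreover have "disjoint_family_on A {..<4}"
    proof -
      have "I b \<inter> J b' = {}" for b b'
        using IJ(1)[of b] IJ(2)[of b'] IJ(3)[of b] Bdisj[of b b'] by (cases "b = b'") auto
      then have same: "\<Union> (I ` S) \<inter> \<Union> (J ` S') = {}" for S S' by blast
      have disj: "F b \<inter> F b' = {}" if "F = I \<or> F = J" "b \<noteq> b'" for F b b'
        using that(1) IJ(1,2)[of b] IJ(1,2)[of b'] Bdisj[OF that(2)] by blast
      have other: "\<Union> (F ` P) \<inter> \<Union> (F ` R) = {}" if "F = I \<or> F = J" for F
      proof (rule equals0I)
        fix i assume "i \<in> \<Union> (F ` P) \<inter> \<Union> (F ` R)"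
        then obtain b b' where "b \<in> P" "b' \<in> R" "i \<in> F b" "i \<in> F b'" by blast
        moreover from this have "b \<noteq> b'" using PR(3) by blast
        ultimately show False using disj[OF that, of b b'] by blast
      qed
      show ?thesis
        unfolding disjoint_family_on_def four
        using same other[of I] other[of J] by (auto simp: A_def)
    qed
    ultimately show False using \<open>\<not> ?four\<close> by blast
  qed
qed

section \<open>Simultaneous recurrence of squares\<close>

text \<open>After expanding the square, fewer than \<open>K^2\<close> off-diagonal terms (none if
  \<open>K = 0\<close>) have coefficients at most \<open>C^2\<close>, each costing at most
  \<open>C^2 * \<eta>\<close>.\<close>

lemma dist_int_square_of_combination:
  fixes x b :: "nat \<Rightarrow> nat" and a :: real
  assumes orth: "\<And>i j. \<lbrakk>i < K; j < K; i \<noteq> j\<rbrakk> \<Longrightarrow> dist_int (real (x i) * real (x j) * a) \<le> \<eta>"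
    and b: "\<And>i. i < K \<Longrightarrow> b i \<le> C" and "\<eta> \<ge> 0"
  shows "dist_int (real (\<Sum>i<K. b i * x i) ^ 2 * a)
    \<le> dist_int (\<Sum>i<K. real (b i ^ 2) * (real (x i) ^ 2 * a)) + (real K * real C) ^ 2 * \<eta>"
proof -
  define f where "f i j = real (b i * b j) * (real (x i) * real (x j) * a)" for i j
  have "real (\<Sum>i<K. b i * x i) ^ 2 * a = (\<Sum>i<K. \<Sum>j<K. f i j)"
    unfolding of_nat_sum power2_eq_square sum_product
    unfolding sum_distrib_right by (simp add: f_def algebra_simps)
  also have "\<dots> = (\<Sum>i<K. f i i + (\<Sum>j\<in>{..<K} - {i}. f i j))"
    by (intro sum.cong refl sum.remove) auto
  also have "\<dots> = (\<Sum>i<K. f i i) + (\<Sum>i<K. \<Sum>j\<in>{..<K} - {i}. f i j)"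
    by (rule sum.distrib)
  finally have eq: "real (\<Sum>i<K. b i * x i) ^ 2 * a = \<dots>" .
  have "dist_int (f i j) \<le> real C ^ 2 * \<eta>" if "i < K" "j < K" "i \<noteq> j" for i j
  proof -
    have "dist_int (f i j) \<le> real (b i * b j) * dist_int (real (x i) * real (x j) * a)"
      unfolding f_def by (rule dist_int_nat_mult)
    also have "\<dots> \<le> real (C * C) * \<eta>"
      by (intro mult_mono of_nat_mono mult_le_mono b orth that dist_int_nonneg) auto
    finally show ?thesis by (simp add: power2_eq_square)
  qed
  then have "(\<Sum>i<K. \<Sum>j\<in>{..<K} - {i}. dist_int (f i j)) \<le> (\<Sum>i<K. \<Sum>j\<in>{..<K} - {i}. real C ^ 2 * \<eta>)"
    by (intro sum_mono) auto
  also have "\<dots> \<le> (\<Sum>i<K. \<Sum>j<K. real C ^ 2 * \<eta>)"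
    using assms(3) by (intro sum_mono sum_mono2) auto
  also have "\<dots> = (real K * real C) ^ 2 * \<eta>" by (simp add: power2_eq_square)
  finally have off: "(\<Sum>i<K. \<Sum>j\<in>{..<K} - {i}. dist_int (f i j)) \<le> \<dots>" .
  have "dist_int (\<Sum>i<K. \<Sum>j\<in>{..<K} - {i}. f i j) \<le> (\<Sum>i<K. \<Sum>j\<in>{..<K} - {i}. dist_int (f i j))"
    by (intro order_trans[OF dist_int_sum] sum_mono dist_int_sum)
  then have "dist_int (real (\<Sum>i<K. b i * x i) ^ 2 * a) \<le> dist_int (\<Sum>i<K. f i i) + (real K * real C) ^ 2 * \<eta>"
    unfolding eq using off dist_int_add[of "\<Sum>i<K. f i i" "\<Sum>i<K. \<Sum>j\<in>{..<K} - {i}. f i j"] by linarith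
  then show ?thesis by (simp add: f_def power2_eq_square mult.assoc)
qed

text \<open>The three errors come from Dirichlet applied to the common sum, from replacing the four
  subset sums by that common one with total weight at most \<open>Q ^ d\<close>, and from the cross
  terms.\<close>

lemma square_recurrence_parametric:
  fixes \<alpha> :: "nat \<Rightarrow> real" and d k Q M E :: nat
  assumes "Q > 0" "M > 0" "E > 0" "M ^ d < 2 ^ k"
  obtains n where "1 \<le> n" "n \<le> (k * k) * (Q ^ d * E ^ (k * k * d))"
    "\<And>l. l < d \<Longrightarrow> dist_int (real n ^ 2 * \<alpha> l) \<le>
      1 / real Q + real (Q ^ d) * (real (k + 1) / real M) + (real (k * k) * real (Q ^ d)) ^ 2 * (1 / real E)"
proof -
  note conclude = that
  define K C where "K = k * k" and "C = Q ^ d"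
  have C: "C \<ge> 1" using assms by (simp add: C_def)
  obtain x :: "nat \<Rightarrow> nat" where x: "\<And>i. i < K \<Longrightarrow> 1 \<le> x i" "\<And>i. i < K \<Longrightarrow> x i \<le> E ^ (K * d)"
    "\<And>i j l. \<lbrakk>i < K; j < K; i \<noteq> j; l < d\<rbrakk> \<Longrightarrow> dist_int (real (x i) * real (x j) * \<alpha> l) \<le> 1 / real E"
    using nearly_orthogonal_sequence[OF assms(3), of K d \<alpha>] by blast
  define w where "w i l = real (x i) ^ 2 * \<alpha> l" for i l
  \<comment> \<open>Both cases only have to supply coefficients with a small diagonal sum; one
    nonzero coefficient ensures \<open>n\<close> is positive.\<close>
  have reduce: thesis
    if b: "\<And>i. i < K \<Longrightarrow> b i \<le> C" and "i0 < K" "b i0 \<ge> 1"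
      and diag: "\<And>l. l < d \<Longrightarrow> dist_int (\<Sum>i<K. real (b i ^ 2) * w i l)
        \<le> 1 / real Q + real C * (real (k + 1) / real M)" for b i0
  proof (rule conclude)
    have "1 \<le> b i0 * x i0" using that(2,3) x(1)[of i0] by simp
    also have "\<dots> \<le> (\<Sum>i<K. b i * x i)" using that(2) by (intro member_le_sum) auto
    finally show "1 \<le> (\<Sum>i<K. b i * x i)" .
    have "(\<Sum>i<K. b i * x i) \<le> (\<Sum>i<K. C * E ^ (K * d))"
      using b x(2) by (intro sum_mono mult_le_mono) auto
    then show "(\<Sum>i<K. b i * x i) \<le> (k * k) * (Q ^ d * E ^ (k * k * d))"
      by (simp add: K_def C_def)
    show "dist_int (real (\<Sum>i<K. b i * x i) ^ 2 * \<alpha> l) \<le>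
      1 / real Q + real (Q ^ d) * (real (k + 1) / real M) + (real (k * k) * real (Q ^ d)) ^ 2 * (1 / real E)"
      if "l < d" for l
    proof -
      have "dist_int (real (\<Sum>i<K. b i * x i) ^ 2 * \<alpha> l)
        \<le> dist_int (\<Sum>i<K. real (b i ^ 2) * (real (x i) ^ 2 * \<alpha> l)) + (real K * real C) ^ 2 * (1 / real E)"
        using x(3) b \<open>l < d\<close> by (intro dist_int_square_of_combination) auto
      then show ?thesis using diag[OF that] unfolding w_def K_def C_def by linarith
    qed
  qed
  consider (zero) A where "A \<subseteq> {..<K}" "A \<noteq> {}" "\<forall>l<d. dist_int (\<Sum>i\<in>A. w i l) \<le> 1 / real M"
    | (four) A where "\<forall>s<4. A s \<subseteq> {..<K} \<and> A s \<noteq> {}" "disjoint_family_on A {..<4::nat}"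
      "\<forall>s<4. \<forall>l<d. dist_int ((\<Sum>i\<in>A s. w i l) - (\<Sum>i\<in>A 0. w i l)) \<le> real (k + 1) / real M"
    using four_close_subset_sums[OF assms(2,4), of w] unfolding K_def[symmetric] by blast
  then show thesis
  proof cases
    case zero
    then obtain i0 where i0: "i0 \<in> A" "i0 < K" by blast
    define b :: "nat \<Rightarrow> nat" where "b i = (if i \<in> A then 1 else 0)" for i
    show thesis
    proof (rule reduce)
      show "b i \<le> C" for i using C by (simp add: b_def)
      show "i0 < K" "b i0 \<ge> 1" using i0 by (simp_all add: b_def)
      show "dist_int (\<Sum>i<K. real (b i ^ 2) * w i l) \<le> 1 / real Q + real C * (real (k + 1) / real M)"
        if "l < d" for l
      proof -
        have "(\<Sum>i<K. real (b i ^ 2) * w i l) = (\<Sum>i<K. if i \<in> A then w i l else 0)"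
          by (intro sum.cong) (auto simp: b_def)
        also have "\<dots> = (\<Sum>i\<in>A. w i l)"
          using zero(1) by (simp add: sum.inter_restrict[symmetric] Int_absorb1)
        finally have "dist_int (\<Sum>i<K. real (b i ^ 2) * w i l) \<le> 1 / real M"
          using zero(3) that by simp
        also have "\<dots> \<le> real C * (real (k + 1) / real M)"
        proof -
          have "1 \<le> C * (k + 1)" using C by simp
          then have "1 \<le> real C * real (k + 1)" by (metis of_nat_1 of_nat_le_iff of_nat_mult)
          then show ?thesis using divide_right_mono[of 1 "real C * real (k + 1)" "real M"] by simp
        qed
        finally show ?thesis by (simp add: add_increasing)
      qed
    qed
  next
    case four
    obtain c where c: "1 \<le> c" "c \<le> C" "\<And>l. l < d \<Longrightarrow> dist_int (real c * (\<Sum>i\<in>A 0. w i l)) \<le> 1 / real Q"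
      using dist_int_dirichlet[OF assms(1), of d "\<lambda>l. \<Sum>i\<in>A 0. w i l"] unfolding C_def by blast
    obtain a0 a1 a2 a3 where a03: "c = a0\<^sup>2 + a1\<^sup>2 + a2\<^sup>2 + a3\<^sup>2" by (rule lagrange_four_squares)
    define a where "a s = (if s = 0 then a0 else if s = 1 then a1 else if s = 2 then a2 else a3)" for s :: nat
    have "{..<4} = {0, 1, 2, 3::nat}" by auto
    then have ac: "(\<Sum>s<4. (a s)\<^sup>2) = c" by (simp add: a03 a_def)
    have a_le: "a s \<le> C" if "s < 4" for s
    proof -
      have "a s \<le> (a s)\<^sup>2" by (simp add: power2_eq_square)
      also have "\<dots> \<le> c" unfolding ac[symmetric] using that by (intro member_le_sum) auto
      finally show ?thesis using c(2) by simp
    qed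
    \<comment> \<open>The sets \<open>A s\<close> are disjoint, so at most one summand is nonzero
      and squaring acts termwise.\<close>
    define b where "b i = (\<Sum>s<4. if i \<in> A s then a s else 0)" for i
    have pick: "(\<Sum>s<4. if i \<in> A s then g s else 0) = g s0" if "i \<in> A s0" "s0 < 4" for g :: "nat \<Rightarrow> nat" and i s0
    proof -
      have "(\<Sum>s<4. if i \<in> A s then g s else 0) = (\<Sum>s<4. if s = s0 then g s else 0)"
        using that four(2) by (intro sum.cong) (auto simp: disjoint_family_on_def)
      then show ?thesis using that by simp
    qed
    have b_sq: "(b i)\<^sup>2 = (\<Sum>s<4. if i \<in> A s then (a s)\<^sup>2 else 0)" for i
    proof (cases "\<forall>s<4. i \<notin> A s")
      case True
      then show ?thesis by (simp add: b_def)
    next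
      case False
      then obtain s where "s < 4" "i \<in> A s" by blast
      then show ?thesis using pick[of i s a] pick[of i s "\<lambda>s. (a s)\<^sup>2"] by (simp add: b_def)
    qed
    have "\<exists>s<4. a s \<noteq> 0" using ac c(1) by (metis (no_types, lifting) lessThan_iff not_one_le_zero sum.neutral zero_power2)
    then obtain s0 where s0: "s0 < 4" "a s0 \<noteq> 0" by blast
    then obtain i0 where i0: "i0 \<in> A s0" "i0 < K" using four(1) by blast
    show thesis
    proof (rule reduce)
      show "b i \<le> C" for i
      proof (cases "\<forall>s<4. i \<notin> A s")
        case False
        then obtain s where "s < 4" "i \<in> A s" by blast
        then show ?thesis using pick[of i s a] a_le by (simp add: b_def)
      qed (simp add: b_def)
      show "i0 < K" "b i0 \<ge> 1" using i0 s0 pick[of i0 s0 a] by (simp_all add: b_def)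
      show "dist_int (\<Sum>i<K. real (b i ^ 2) * w i l) \<le> 1 / real Q + real C * (real (k + 1) / real M)"
        if "l < d" for l
      proof -
        define W where "W s = (\<Sum>i\<in>A s. w i l)" for s
        have "(\<Sum>i<K. real (b i ^ 2) * w i l) = (\<Sum>i<K. \<Sum>s<4. if i \<in> A s then real ((a s)\<^sup>2) * w i l else 0)"
          unfolding b_sq of_nat_sum sum_distrib_right by (intro sum.cong refl) auto
        also have "\<dots> = (\<Sum>s<4. \<Sum>i<K. if i \<in> A s then real ((a s)\<^sup>2) * w i l else 0)"
          by (rule sum.swap)
        also have "\<dots> = (\<Sum>s<4. real ((a s)\<^sup>2) * W s)"
        proof (intro sum.cong refl)
          fix s :: nat assume "s \<in> {..<4}"
          then have "{..<K} \<inter> A s = A s" using four(1) by blast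
          then show "(\<Sum>i<K. if i \<in> A s then real ((a s)\<^sup>2) * w i l else 0) = real ((a s)\<^sup>2) * W s"
            by (simp add: sum.inter_restrict[symmetric] W_def sum_distrib_left)
        qed
        \<comment> \<open>The squares \<open>(a s)^2\<close> add up to \<open>c\<close>, so
          comparing every \<open>W s\<close> with \<open>W 0\<close> leaves exactly
          \<open>c * W 0\<close>.\<close>
        also have "\<dots> = (\<Sum>s<4. real ((a s)\<^sup>2) * (W s - W 0)) + real c * W 0"
          unfolding ac[symmetric] of_nat_sum sum_distrib_right sum.distrib[symmetric]
          by (simp add: algebra_simps)
        finally have eq: "(\<Sum>i<K. real (b i ^ 2) * w i l) = \<dots>" .
        have "dist_int (\<Sum>s<4. real ((a s)\<^sup>2) * (W s - W 0)) \<le> (\<Sum>s<4. dist_int (real ((a s)\<^sup>2) * (W s - W 0)))"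
          by (rule dist_int_sum)
        also have "\<dots> \<le> (\<Sum>s<4. real ((a s)\<^sup>2) * (real (k + 1) / real M))"
          using four(3) that unfolding W_def
          by (intro sum_mono order_trans[OF dist_int_nat_mult] mult_left_mono) auto
        also have "\<dots> = real c * (real (k + 1) / real M)"
          unfolding ac[symmetric] of_nat_sum sum_distrib_right ..
        also have "\<dots> \<le> real C * (real (k + 1) / real M)"
          using c(2) by (intro mult_right_mono) auto
        finally show ?thesis
          unfolding eq using c(3)[OF that] dist_int_add[of "\<Sum>s<4. real ((a s)\<^sup>2) * (W s - W 0)" "real c * W 0"]
          unfolding W_def by linarith
      qed
    qed
  qed
qed

text \<open>Powers of two are chosen so that each of the three errors is at most
  \<open>1 / Q\<close>, a quarter of the target \<open>1 / 2 ^ m\<close>.\<close>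

lemma square_recurrence:
  fixes \<alpha> :: "nat \<Rightarrow> real" and d m :: nat
  assumes "d \<ge> 1" "m \<ge> 1"
  obtains n where "1 \<le> n" "n \<le> 2 ^ (20000 * m ^ 3 * d ^ 6)"
    "\<And>l. l < d \<Longrightarrow> dist_int (real n ^ 2 * \<alpha> l) \<le> 1 / 2 ^ m"
proof -
  define D where "D = m * d"
  \<comment> \<open>\<open>M ^ d\<close> will be \<open>2 ^ (16 * m * d ^ 2)\<close>; the extra 1
    makes the pigeonhole inequality strict.\<close>
  define k where "k = 16 * m * d ^ 2 + 1"
  have D: "m \<le> D" "d \<le> D" "1 \<le> D" using assms by (auto simp: D_def)
  have le2: "(t::nat) \<le> 2 ^ t" for t using less_exp[of t] by simp
  have "k + 1 \<le> 18 * (m * d ^ 2)" using assms by (simp add: k_def)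
  also have "\<dots> \<le> 2 ^ 5 * (2 ^ m * (2 ^ d) ^ 2)"
    by (intro mult_le_mono power_mono le2) auto
  also have "\<dots> = 2 ^ (5 + (m + d * 2))" by (simp add: power_add power_mult)
  also have "\<dots> \<le> 2 ^ (8 * D)" using D by (intro power_increasing) auto
  finally have k1: "k + 1 \<le> 2 ^ (8 * D)" .
  \<comment> \<open>\<open>M\<close> must dominate \<open>Q * C * (k + 1)\<close>, at most
    \<open>2 ^ (14 * D)\<close>, and \<open>E\<close> must dominate
    \<open>Q * (k * k * C)^2\<close>, at most \<open>2 ^ (41 * D)\<close>.\<close>
  define Q M E C where "Q = (2::nat) ^ (m + 2)" and "M = (2::nat) ^ (16 * D)" and "E = (2::nat) ^ (64 * D)"
    and "C = Q ^ d"
  have "C = 2 ^ ((m + 2) * d)" by (simp only: C_def Q_def power_mult)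
  also have "\<dots> \<le> 2 ^ (3 * D)"
    unfolding D_def mult.assoc[symmetric] using assms by (intro power_increasing mult_le_mono1) auto
  finally have C: "C \<le> 2 ^ (3 * D)" .
  have Q: "Q \<le> 2 ^ (3 * D)" unfolding Q_def using D by (intro power_increasing) auto
  have "M ^ d < 2 ^ k"
    unfolding M_def k_def power_mult[symmetric]
    by (intro power_strict_increasing) (auto simp: D_def power2_eq_square)
  then obtain n where n: "1 \<le> n" "n \<le> (k * k) * (C * E ^ (k * k * d))"
    "\<And>l. l < d \<Longrightarrow> dist_int (real n ^ 2 * \<alpha> l) \<le>
      1 / real Q + real C * (real (k + 1) / real M) + (real (k * k) * real C) ^ 2 * (1 / real E)"
    using square_recurrence_parametric[of Q M E d k \<alpha>] unfolding C_def by (auto simp: Q_def M_def E_def)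
  have "(k * k) * (C * E ^ (k * k * d)) \<le> (2 ^ (8 * D) * 2 ^ (8 * D)) * (2 ^ (3 * D) * E ^ (k * k * d))"
    using k1 C by (intro mult_le_mono) auto
  also have "\<dots> = 2 ^ (8 * D + 8 * D + (3 * D + 64 * D * (k * k * d)))"
    by (simp only: E_def power_add power_mult[symmetric])
  also have "\<dots> \<le> 2 ^ (20000 * m ^ 3 * d ^ 6)"
  proof (intro power_increasing)
    \<comment> \<open>Here \<open>64 * 17^2 = 18496\<close>, and the remaining \<open>19 * D\<close>
      fits into the slack below 20000.\<close>
    have "k \<le> 17 * (m * d ^ 2)" using assms by (simp add: k_def)
    then have "64 * D * (k * k * d) \<le> 64 * D * ((17 * (m * d ^ 2)) * (17 * (m * d ^ 2)) * d)"
      by (intro mult_le_mono) auto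
    also have "\<dots> = 18496 * (m ^ 3 * d ^ 6)"
    proof -
      have "d ^ 6 = d * d * d * d * d * d" by (simp add: eval_nat_numeral)
      then show ?thesis by (simp add: D_def power2_eq_square power3_eq_cube)
    qed
    finally have "64 * D * (k * k * d) \<le> 18496 * (m ^ 3 * d ^ 6)" .
    moreover have "D \<le> m ^ 3 * d ^ 6"
      unfolding D_def using assms self_le_power[of m 3] self_le_power[of d 6] by (intro mult_le_mono) auto
    ultimately show "8 * D + 8 * D + (3 * D + 64 * D * (k * k * d)) \<le> 20000 * m ^ 3 * d ^ 6"
      unfolding mult.assoc[of 20000] by linarith
  qed simp
  finally have "n \<le> 2 ^ (20000 * m ^ 3 * d ^ 6)" by (rule order_trans[OF n(2)])
  moreover have "dist_int (real n ^ 2 * \<alpha> l) \<le> 1 / 2 ^ m" if "l < d" for l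
  proof -
    have Qm: "real Q = 4 * 2 ^ m" by (simp add: Q_def)
    have "Q * (C * (k + 1)) \<le> 2 ^ (3 * D) * (2 ^ (3 * D) * 2 ^ (8 * D))"
      using Q C k1 by (intro mult_le_mono)
    also have "\<dots> = 2 ^ (3 * D + (3 * D + 8 * D))" by (simp only: power_add)
    also have "\<dots> \<le> M" unfolding M_def by (intro power_increasing) auto
    finally have "real (Q * (C * (k + 1))) \<le> real M" by (rule of_nat_mono)
    then have 1: "real C * (real (k + 1) / real M) \<le> 1 / real Q"
      by (simp add: Q_def M_def field_simps)
    have "Q * (k * k * C)\<^sup>2 \<le> 2 ^ (3 * D) * (2 ^ (8 * D) * 2 ^ (8 * D) * 2 ^ (3 * D))\<^sup>2"
      using Q C k1 by (intro mult_le_mono power_mono) auto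
    also have "\<dots> = 2 ^ (3 * D + (8 * D + 8 * D + 3 * D) * 2)"
      by (simp only: power_add power_mult[of _ _ 2])
    also have "\<dots> \<le> E" unfolding E_def by (intro power_increasing) auto
    finally have "real (Q * (k * k * C)\<^sup>2) \<le> real E" by (rule of_nat_mono)
    then have 2: "(real (k * k) * real C) ^ 2 * (1 / real E) \<le> 1 / real Q"
      by (simp add: Q_def E_def field_simps)
    have "dist_int (real n ^ 2 * \<alpha> l) \<le> 3 * (1 / real Q)"
      using n(3)[OF that] 1 2 by linarith
    also have "\<dots> \<le> 1 / 2 ^ m" by (simp add: Qm field_simps)
    finally show ?thesis .
  qed
  ultimately show ?thesis by (rule that[OF n(1)])
qed

section \<open>Deduction for arbitrary \<open>N\<close>\<close>

theorem theorem1: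
  shows "\<exists>c1::real. c1 > 0 \<and>
    (\<forall>(d::nat) (\<alpha>::nat \<Rightarrow> real) (N::nat). d \<ge> 1 \<longrightarrow> N \<ge> 1 \<longrightarrow>
      (\<exists>n::nat. 1 \<le> n \<and> n \<le> N \<and>
        (\<forall>j\<in>{1..d}. dist_int (real n ^ 2 * \<alpha> j)
           \<le> exp (- c1 * ((real d) powr (-10) * ln (real N)) powr (1/4)))))"
\<comment> \<open>The fourth power of 100 is \<open>10 ^ 8\<close>, which exceeds the factor
  \<open>20000 * 128\<close> met below.\<close>
proof (intro exI[of _ "1 / 100"] conjI allI impI)
  fix d N :: nat and \<alpha> :: "nat \<Rightarrow> real"
  assume d: "d \<ge> 1" and N: "N \<ge> 1"
  define L where "L = real d powr (-10) * ln (real N)"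
  define t where "t = 1 / 100 * L powr (1/4)"
  have "L \<ge> 0" using N by (simp add: L_def)
  have "t \<ge> 0" by (simp add: t_def)
  have "(L powr (1/4)) ^ 4 = L"
    using \<open>L \<ge> 0\<close> by (cases "L = 0") (simp_all add: powr_realpow[symmetric] powr_powr)
  then have t4: "L = 10 ^ 8 * t ^ 4" by (simp add: t_def power_mult_distrib power_divide)
  have "real d ^ 10 * L = ln (real N)"
    using d by (simp add: L_def powr_minus field_simps)
  then have lnN: "ln (real N) = real d ^ 10 * (10 ^ 8 * t ^ 4)" by (simp add: t4)
  have "\<exists>n::nat. 1 \<le> n \<and> n \<le> N \<and> (\<forall>j\<in>{1..d}. dist_int (real n ^ 2 * \<alpha> j) \<le> exp (- t))"
  proof (cases "t \<le> 1 / 2")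
    \<comment> \<open>The target is at least \<open>1 / 2\<close>, so \<open>n = 1\<close>
      suffices.\<close>
    case True
    have "1 / 2 \<le> exp (- t)" using exp_ge_add_one_self[of "- t"] True by linarith
    then have "dist_int (real 1 ^ 2 * \<alpha> j) \<le> exp (- t)" for j
      using dist_int_le_half order_trans by blast
    then show ?thesis using N by blast
  next
    case False
    \<comment> \<open>As \<open>ln 2\<close> exceeds \<open>1 / 2\<close>, this gives
      \<open>2 ^ m \<ge> exp t\<close>; \<open>2 * t > 1\<close> keeps the rounding within
      \<open>m \<le> 4 * t\<close>.\<close>
    define m where "m = nat \<lceil>2 * t\<rceil>"
    have m: "2 * t \<le> real m" "real m \<le> 4 * t" "m \<ge> 1"
      using False unfolding m_def by linarith+
    define T where "T = 20000 * m ^ 3 * d ^ 6"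
    \<comment> \<open>The shift by \<open>Suc\<close> matches indices from 0 with those from
      1.\<close>
    obtain n where n: "1 \<le> n" "n \<le> 2 ^ T"
      "\<And>l. l < d \<Longrightarrow> dist_int (real n ^ 2 * \<alpha> (Suc l)) \<le> 1 / 2 ^ m"
      using square_recurrence[OF d m(3), of "\<lambda>l. \<alpha> (Suc l)"] unfolding T_def by blast
    \<comment> \<open>The exponents 3 and 6 are relaxed to the 4 and 10 of the claim, using
      \<open>2 * t \<ge> 1\<close> and \<open>d \<ge> 1\<close>.\<close>
    have "real m ^ 3 \<le> (4 * t) ^ 3" using m by (intro power_mono) auto
    also have "\<dots> \<le> 64 * t ^ 3 * (2 * t)"
      using False \<open>t \<ge> 0\<close> mult_left_mono[of 1 "2 * t" "64 * t ^ 3"] by (simp add: power_mult_distrib)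
    also have "\<dots> = 128 * t ^ 4" by (simp add: eval_nat_numeral)
    finally have m3: "real m ^ 3 \<le> 128 * t ^ 4" .
    have d10: "real d ^ 6 \<le> real d ^ 10" using d by (intro power_increasing) auto
    have "ln (real (2 ^ T)) = real T * ln 2"
      by (simp add: ln_realpow)
    also have "\<dots> \<le> real T * 1"
      using ln_le_minus_one[of "2::real"] by (intro mult_left_mono) auto
    also have "\<dots> = 20000 * (real m ^ 3 * real d ^ 6)" by (simp add: T_def)
    also have "\<dots> \<le> 20000 * ((128 * t ^ 4) * real d ^ 10)"
      using m3 d10 by (intro mult_left_mono mult_mono) auto
    also have "\<dots> \<le> ln (real N)" unfolding lnN by (simp add: mult_right_mono)
    finally have "real (2 ^ T) \<le> real N"
      using N by (subst (asm) ln_le_cancel_iff) auto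
    then have "n \<le> N" using n(2) of_nat_le_iff order_trans by blast
    have "exp t \<le> exp (real m * (1 / 2))" using m by simp
    also have "\<dots> \<le> exp (real m * ln 2)"
      unfolding exp_le_cancel_iff using ln2_ge_two_thirds by (intro mult_left_mono) auto
    also have "\<dots> = 2 ^ m" by (simp add: exp_of_nat_mult)
    finally have "1 / 2 ^ m \<le> exp (- t)" by (simp add: exp_minus field_simps)
    then have "dist_int (real n ^ 2 * \<alpha> j) \<le> exp (- t)" if "j \<in> {1..d}" for j
    proof -
      have "j - 1 < d" using that by auto
      from n(3)[OF this] show ?thesis using \<open>1 / 2 ^ m \<le> exp (- t)\<close> that by simp
    qed
    then show ?thesis using n(1) \<open>n \<le> N\<close> by blast
  qed
  then show "\<exists>n::nat. 1 \<le> n \<and> n \<le> N \<and> (\<forall>j\<in>{1..d}. dist_int (real n ^ 2 * \<alpha> j)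
           \<le> exp (- (1 / 100) * ((real d) powr (-10) * ln (real N)) powr (1/4)))"
    by (simp add: t_def L_def)
qed simp

end
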